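(* Let $\mathfrak a\subseteq A$ be an ideal, let $f_1,\dots,f_n$ be a sequence of generators of $\mathfrak a$, and for each $f_i$ fix a compatible system of $p$-power roots of $f_i$ in $A_\infty$. Then: (a) For every real $t\ge0$, $\tau^\sharp([f_1,\dots,f_n]^t)\subseteq\tau^\sharp(\mathfrak a^t)$. (b) If $t'>t\ge 0$, then $\tau^\sharp(\mathfrak a^{t'})\subseteq\tau^\sharp(\mathfrak a^t)$ and $\tau^\sharp([f_1,\dots,f_n]^{t'})\subseteq\tau^\sharp([f_1,\dots,f_n]^t)$. (c) If $\mathfrak a\subseteq\mathfrak b$ for an ideal $\mathfrak b\subseteq A$, and $f_1,\dots,f_n,f_{n+1},\dots,f_m$ is a fixed set of generators of $\mathfrak b$ (with a fixed compatible system of $p$-power roots for each $f_i$, the same ones for $i\le n$), then for every $t\ge0$, $\tau^\sharp(\mathfrak a^t)\subseteq\tau^\sharp(\mathfrak b^t)$ and $\tau^\sharp([f_1,\dots,f_n]^t)\subseteq\tau^\sharp([f_1,\dots,f_m]^t)$.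
   Context: Fix a prime $p$. $K^\circ$ denotes the $p$-adic completion of $\mathbb Z_p[p^{1/p^\infty}]$. A $K^\circ$-algebra $S$ is integral perfectoid if it is $p$-adically complete, $p$-torsion free, and Frobenius induces an isomorphism $S/p^{1/p}\to S/p$; by convention every integral perfectoid $S$ is also assumed integrally closed in $S[1/p]$. An element $z$ of a $K^\circ$-module (or a module) is almost zero if it is annihilated by $p^{1/p^k}$ for all $k>0$; "$p^{1/p^\infty}z=0$" means $z$ is almost zero. A compatible system of $p$-power roots of $g$ in $S$ is a sequence $\{g^{1/p^e}\}_{e\ge 0}$ with $g^{1/p^0}=g$ and $(g^{1/p^{e+1}})^p=g^{1/p^e}$. A ring map $A\to S$ with $S$ a $K^\circ$-algebra is almost flat if $\operatorname{Tor}_i^A(M,S)$ is almost zero for all $A$-modules $M$ and $i>0$. $(A,\mathfrak m)$ is a complete regular local ring of mixed characteristic $(0,p)$ and dimension $d$. $A\to A_\infty$ is a fixed map to an integral perfectoid $K^\circ$-algebra such that: (a) every element of $A$ has a compatible system of $p$-power roots in $A_\infty$; (b) $A\to A_\infty$ is almost flat (so it is injective, and nonzero elements of $A$ are nonzerodivisors on $A_\infty$); (c) if $M$ is an $A$-module with $M\otimes_AA_\infty$ almost zero, then $M=0$. For an ideal $\mathfrak a\subseteq A$ and real $t\ge0$, let $0^{\diamondsuit\mathfrak a^t}_{H^d_{\mathfrak m}(A)}$ be the set of $\eta\in H^d_{\mathfrak m}(A)$ such that for all $e>0$, all $f\in\mathfrak a^{\lceil tp^e\rceil}$ and all $p^e$-th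 roots $f^{1/p^e}\in A_\infty$ of $f$ that are part of some compatible system of $p$-power roots of $f$, one has $p^{1/p^\infty}f^{1/p^e}\eta=0$ in $H^d_{\mathfrak m}(A_\infty)$. Put $\tau^\sharp(\mathfrak a^t)=\operatorname{Ann}_A\big(0^{\diamondsuit\mathfrak a^t}_{H^d_{\mathfrak m}(A)}\big)$. For $f_1,\dots,f_n\in A$ with one fixed compatible system $\{f_i^{1/p^e}\}_e$ for each $i$ (data denoted $[f_1,\dots,f_n]$), let $0^{\diamondsuit[f_1,\dots,f_n]^t}_{H^d_{\mathfrak m}(A)}$ be the set of $\eta\in H^d_{\mathfrak m}(A)$ such that for all $e>0$, $p^{1/p^\infty}g\eta=0$ in $H^d_{\mathfrak m}(A_\infty)$ for every product $g=\prod_{i=1}^af_{j_i}^{1/p^e}$ of the chosen roots (repetitions allowed) with integer $a\ge tp^e$. Put $\tau^\sharp([f_1,\dots,f_n]^t)=\operatorname{Ann}_A\big(0^{\diamondsuit[f_1,\dots,f_n]^t}_{H^d_{\mathfrak m}(A)}\big)$. *)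

theory Defs
  imports
    "HOL-Library.Extended_Nat"
    "HOL-Algebra.Ideal_Product"
    "HOL-Algebra.Ring_Divisibility"
    "HOL-Algebra.IntRing"
begin

section \<open>Rings: powers of ideals, adic completion, dimension\<close>

primrec ideal_pow :: "('a, 'z) ring_scheme \<Rightarrow> 'a set \<Rightarrow> nat \<Rightarrow> 'a set" where
  "ideal_pow R I 0 = carrier R"
| "ideal_pow R I (Suc n) = ideal_prod R (ideal_pow R I n) I"

text \<open>The inverse limit of the rings \<open>R / I\<^sup>n\<close>; the transition maps send a coset of \<open>I\<^sup>n\<^sup>+\<^sup>1\<close> to the
  unique coset of \<open>I\<^sup>n\<close> that contains it.\<close>

definition adic_completion :: "('a, 'z) ring_scheme \<Rightarrow> 'a set \<Rightarrow> (nat \<Rightarrow> 'a set) ring" where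
  "adic_completion R I =
    \<lparr>carrier = {x. (\<forall>n. x n \<in> carrier (R Quot ideal_pow R I n)) \<and> (\<forall>n. x (Suc n) \<subseteq> x n)},
     monoid.mult = (\<lambda>x y n. x n \<otimes>\<^bsub>R Quot ideal_pow R I n\<^esub> y n),
     one = (\<lambda>n. \<one>\<^bsub>R Quot ideal_pow R I n\<^esub>),
     zero = (\<lambda>n. \<zero>\<^bsub>R Quot ideal_pow R I n\<^esub>),
     add = (\<lambda>x y n. x n \<oplus>\<^bsub>R Quot ideal_pow R I n\<^esub> y n)\<rparr>"

definition completion_map :: "('a, 'z) ring_scheme \<Rightarrow> 'a set \<Rightarrow> 'a \<Rightarrow> nat \<Rightarrow> 'a set" where
  "completion_map R I x = (\<lambda>n. ideal_pow R I n +>\<^bsub>R\<^esub> x)"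

text \<open>Completeness includes separatedness.\<close>

definition adically_complete :: "('a, 'z) ring_scheme \<Rightarrow> 'a set \<Rightarrow> bool" where
  "adically_complete R I \<longleftrightarrow>
     bij_betw (completion_map R I) (carrier R) (carrier (adic_completion R I))"

definition krull_dim :: "('a, 'z) ring_scheme \<Rightarrow> enat" where
  "krull_dim R =
     (SUP n \<in> {n. \<exists>P :: nat \<Rightarrow> 'a set.
        (\<forall>i\<le>n. primeideal (P i) R) \<and> (\<forall>i<n. P i \<subset> P (Suc i))}. enat n)"

definition local_ring :: "('a, 'z) ring_scheme \<Rightarrow> 'a set \<Rightarrow> bool" where
  "local_ring R \<mm> \<longleftrightarrow> cring R \<and> maximalideal \<mm> R \<and> (\<forall>M. maximalideal M R \<longrightarrow> M = \<mm>)"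

definition regular_local_ring :: "('a, 'z) ring_scheme \<Rightarrow> 'a set \<Rightarrow> nat \<Rightarrow> bool" where
  "regular_local_ring R \<mm> d \<longleftrightarrow>
     local_ring R \<mm> \<and> noetherian_ring R \<and> krull_dim R = enat d \<and>
     (\<exists>X \<subseteq> carrier R. finite X \<and> card X = d \<and> Idl\<^bsub>R\<^esub> X = \<mm>)"

text \<open>The ring has characteristic \<open>0\<close> and its residue field has characteristic \<open>p\<close>.\<close>

definition mixed_characteristic :: "nat \<Rightarrow> ('a, 'z) ring_scheme \<Rightarrow> 'a set \<Rightarrow> bool" where
  "mixed_characteristic p R \<mm> \<longleftrightarrow>
     (\<forall>n::nat. n > 0 \<longrightarrow> [n] \<cdot>\<^bsub>R\<^esub> \<one>\<^bsub>R\<^esub> \<noteq> \<zero>\<^bsub>R\<^esub>) \<and> [p] \<cdot>\<^bsub>R\<^esub> \<one>\<^bsub>R\<^esub> \<in> \<mm>"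


section \<open>Modules\<close>

text \<open>The multiplication and unit fields of a module record play no role for a module which is not an
  algebra; they are left undefined below.\<close>

definition self_module :: "('a, 'z) ring_scheme \<Rightarrow> ('a, 'a) module" where
  "self_module R = \<lparr>carrier = carrier R, monoid.mult = monoid.mult R, one = one R, zero = zero R,
     add = add R, smult = monoid.mult R\<rparr>"

definition module_span :: "('r, 'z) ring_scheme \<Rightarrow> ('r, 'm) module \<Rightarrow> 'm set \<Rightarrow> 'm set" where
  "module_span R M X = \<Inter>{H. submodule H R M \<and> X \<subseteq> H}"

definition quotient_module :: "('r, 'm) module \<Rightarrow> 'm set \<Rightarrow> ('r, 'm set) module" where
  "quotient_module M N =
    \<lparr>carrier = a_rcosets\<^bsub>M\<^esub> N, monoid.mult = undefined, one = undefined, zero = N, add = set_add M,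
     smult = (\<lambda>r X. \<Union>x\<in>X. N +>\<^bsub>M\<^esub> (r \<odot>\<^bsub>M\<^esub> x))\<rparr>"

definition subquotient :: "('r, 'm) module \<Rightarrow> 'm set \<Rightarrow> 'm set \<Rightarrow> ('r, 'm set) module" where
  "subquotient M Z B = quotient_module (M\<lparr>carrier := Z\<rparr>) B"

text \<open>\<open>quotient_map N B' h\<close> is the map on cosets, with values in the cosets of \<open>B'\<close> in \<open>N\<close>,
  induced by a map \<open>h\<close> on representatives.\<close>

definition quotient_map ::
  "('r, 'n) module \<Rightarrow> 'n set \<Rightarrow> ('m \<Rightarrow> 'n) \<Rightarrow> 'm set \<Rightarrow> 'n set" where
  "quotient_map N B' h X = the_elem ((\<lambda>x. B' +>\<^bsub>N\<^esub> h x) ` X)"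

definition annihilator :: "('r, 'z) ring_scheme \<Rightarrow> ('r, 'm) module \<Rightarrow> 'm set \<Rightarrow> 'r set" where
  "annihilator R M X = {a \<in> carrier R. \<forall>x\<in>X. a \<odot>\<^bsub>M\<^esub> x = \<zero>\<^bsub>M\<^esub>}"

definition free_module :: "('r, 'z) ring_scheme \<Rightarrow> 'b set \<Rightarrow> ('r, 'b \<Rightarrow> 'r) module" where
  "free_module R B =
    \<lparr>carrier = {c. (\<forall>b. c b \<in> carrier R) \<and> finite {b. c b \<noteq> \<zero>\<^bsub>R\<^esub>} \<and> {b. c b \<noteq> \<zero>\<^bsub>R\<^esub>} \<subseteq> B},
     monoid.mult = undefined, one = undefined,
     zero = (\<lambda>b. \<zero>\<^bsub>R\<^esub>), add = (\<lambda>c c' b. c b \<oplus>\<^bsub>R\<^esub> c' b),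
     smult = (\<lambda>r c b. r \<otimes>\<^bsub>R\<^esub> c b)\<rparr>"

definition basis_elt :: "('r, 'z) ring_scheme \<Rightarrow> 'b \<Rightarrow> 'b \<Rightarrow> 'r" where
  "basis_elt R b = (\<lambda>b'. if b' = b then \<one>\<^bsub>R\<^esub> else \<zero>\<^bsub>R\<^esub>)"

text \<open>The linear map from a free module to \<open>N\<close> with prescribed values \<open>g\<close> on the basis.\<close>

definition linear_ext ::
  "('r, 'z) ring_scheme \<Rightarrow> ('r, 'n) module \<Rightarrow> ('b \<Rightarrow> 'n) \<Rightarrow> ('b \<Rightarrow> 'r) \<Rightarrow> 'n" where
  "linear_ext R N g c = (\<Oplus>\<^bsub>N\<^esub>b\<in>{b. c b \<noteq> \<zero>\<^bsub>R\<^esub>}. c b \<odot>\<^bsub>N\<^esub> g b)"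


section \<open>Extension of scalars\<close>

text \<open>For a ring map \<open>\<phi> : A \<rightarrow> S\<close> and an \<open>A\<close>-module \<open>M\<close>, the \<open>S\<close>-module \<open>M \<otimes>\<^sub>A S\<close> is the free
  \<open>S\<close>-module on symbols \<open>[x]\<close> (standing for \<open>x \<otimes> 1\<close>), \<open>x \<in> M\<close>, modulo the relations
  \<open>[x + y] = [x] + [y]\<close> and \<open>[a x] = \<phi>(a) [x]\<close>.\<close>

definition base_change_rels ::
  "('a, 'z) ring_scheme \<Rightarrow> ('s, 'y) ring_scheme \<Rightarrow> ('a \<Rightarrow> 's) \<Rightarrow> ('a, 'm) module \<Rightarrow> ('m \<Rightarrow> 's) set"
where
  "base_change_rels A S \<phi> M =
    module_span S (free_module S (carrier M))
     ({basis_elt S (x \<oplus>\<^bsub>M\<^esub> y) \<ominus>\<^bsub>free_module S (carrier M)\<^esub>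
         (basis_elt S x \<oplus>\<^bsub>free_module S (carrier M)\<^esub> basis_elt S y)
        | x y. x \<in> carrier M \<and> y \<in> carrier M} \<union>
      {basis_elt S (a \<odot>\<^bsub>M\<^esub> x) \<ominus>\<^bsub>free_module S (carrier M)\<^esub>
         (\<phi> a \<odot>\<^bsub>free_module S (carrier M)\<^esub> basis_elt S x)
        | a x. a \<in> carrier A \<and> x \<in> carrier M})"

definition base_change ::
  "('a, 'z) ring_scheme \<Rightarrow> ('s, 'y) ring_scheme \<Rightarrow> ('a \<Rightarrow> 's) \<Rightarrow> ('a, 'm) module
    \<Rightarrow> ('s, ('m \<Rightarrow> 's) set) module" where
  "base_change A S \<phi> M =
     quotient_module (free_module S (carrier M)) (base_change_rels A S \<phi> M)"

text \<open>The map \<open>h \<otimes> 1\<close> into \<open>N \<otimes>\<^sub>A S\<close> for an \<open>A\<close>-linear map \<open>h\<close> into \<open>N\<close>.\<close>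

definition base_change_map ::
  "('a, 'z) ring_scheme \<Rightarrow> ('s, 'y) ring_scheme \<Rightarrow> ('a \<Rightarrow> 's) \<Rightarrow> ('a, 'n) module
    \<Rightarrow> ('m \<Rightarrow> 'n) \<Rightarrow> ('m \<Rightarrow> 's) set \<Rightarrow> ('n \<Rightarrow> 's) set" where
  "base_change_map A S \<phi> N h =
     quotient_map (free_module S (carrier N)) (base_change_rels A S \<phi> N)
       (linear_ext S (free_module S (carrier N)) (\<lambda>x. basis_elt S (h x)))"


section \<open>Tor\<close>

text \<open>A canonical free resolution of \<open>M\<close>: the basis in degree \<open>0\<close> is (a copy of) \<open>M\<close> itself, and the
  basis in degree \<open>n + 1\<close> consists of the cycles in degree \<open>n\<close>, each with all of its presentations
  by a finite list of pairs (basis element, coefficient); repeating a generator does no harm.  The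
  datatype houses the bases of all degrees in one type.\<close>

datatype ('m, 'a) syzygy = Gen (gen_elt: 'm) | Syz (syz_list: "(('m, 'a) syzygy \<times> 'a) list")

definition syz_vec ::
  "('a, 'z) ring_scheme \<Rightarrow> ('m, 'a) syzygy \<Rightarrow> ('m, 'a) syzygy \<Rightarrow> 'a" where
  "syz_vec A w b = (case map_of (syz_list w) b of None \<Rightarrow> \<zero>\<^bsub>A\<^esub> | Some a \<Rightarrow> a)"

fun res_basis :: "('a, 'z) ring_scheme \<Rightarrow> ('a, 'm) module \<Rightarrow> nat \<Rightarrow> ('m, 'a) syzygy set" where
  "res_basis A M 0 = Gen ` carrier M"
| "res_basis A M (Suc 0) =
     {Syz l | l. syz_vec A (Syz l) \<in> carrier (free_module A (res_basis A M 0)) \<and>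
        linear_ext A M gen_elt (syz_vec A (Syz l)) = \<zero>\<^bsub>M\<^esub>}"
| "res_basis A M (Suc (Suc n)) =
     {Syz l | l. syz_vec A (Syz l) \<in> carrier (free_module A (res_basis A M (Suc n))) \<and>
        linear_ext A (free_module A (res_basis A M n)) (syz_vec A) (syz_vec A (Syz l)) =
          \<zero>\<^bsub>free_module A (res_basis A M n)\<^esub>}"

definition res_module ::
  "('a, 'z) ring_scheme \<Rightarrow> ('a, 'm) module \<Rightarrow> nat \<Rightarrow> ('a, ('m, 'a) syzygy \<Rightarrow> 'a) module" where
  "res_module A M n = free_module A (res_basis A M n)"

text \<open>\<open>res_diff A M n\<close> goes from degree \<open>n + 1\<close> to degree \<open>n\<close>.\<close>

definition res_diff ::
  "('a, 'z) ring_scheme \<Rightarrow> ('a, 'm) module \<Rightarrow> nat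
    \<Rightarrow> (('m, 'a) syzygy \<Rightarrow> 'a) \<Rightarrow> ('m, 'a) syzygy \<Rightarrow> 'a" where
  "res_diff A M n = linear_ext A (res_module A M n) (syz_vec A)"

text \<open>\<open>Tor A S \<phi> M i\<close> is \<open>Tor\<^sub>i\<^sup>A(M, S)\<close> with its \<open>S\<close>-module structure.\<close>

fun Tor ::
  "('a, 'z) ring_scheme \<Rightarrow> ('s, 'y) ring_scheme \<Rightarrow> ('a \<Rightarrow> 's) \<Rightarrow> ('a, 'm) module \<Rightarrow> nat
    \<Rightarrow> ('s, ((('m, 'a) syzygy \<Rightarrow> 'a) \<Rightarrow> 's) set set) module" where
  "Tor A S \<phi> M 0 =
     subquotient (base_change A S \<phi> (res_module A M 0))
       (carrier (base_change A S \<phi> (res_module A M 0)))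
       (base_change_map A S \<phi> (res_module A M 0) (res_diff A M 0) `
          carrier (base_change A S \<phi> (res_module A M 1)))"
| "Tor A S \<phi> M (Suc n) =
     subquotient (base_change A S \<phi> (res_module A M (Suc n)))
       {z \<in> carrier (base_change A S \<phi> (res_module A M (Suc n))).
          base_change_map A S \<phi> (res_module A M n) (res_diff A M n) z =
            \<zero>\<^bsub>base_change A S \<phi> (res_module A M n)\<^esub>}
       (base_change_map A S \<phi> (res_module A M (Suc n)) (res_diff A M (Suc n)) `
          carrier (base_change A S \<phi> (res_module A M (Suc (Suc n)))))"


section \<open>Localization\<close>

text \<open>\<open>frac R M s x k\<close> is the fraction \<open>x / s\<^sup>k\<close> in \<open>M[1/s]\<close>, as a class of pairs.\<close>

definition frac ::
  "('r, 'z) ring_scheme \<Rightarrow> ('r, 'm) module \<Rightarrow> 'r \<Rightarrow> 'm \<Rightarrow> nat \<Rightarrow> ('m \<times> nat) set" where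
  "frac R M s x k =
     {(y, l). y \<in> carrier M \<and>
        (\<exists>j::nat. (s [^]\<^bsub>R\<^esub> j) \<odot>\<^bsub>M\<^esub> ((s [^]\<^bsub>R\<^esub> l) \<odot>\<^bsub>M\<^esub> x) = (s [^]\<^bsub>R\<^esub> j) \<odot>\<^bsub>M\<^esub> ((s [^]\<^bsub>R\<^esub> k) \<odot>\<^bsub>M\<^esub> y))}"

text \<open>The multiplication and unit are only meaningful when \<open>M\<close> is an \<open>R\<close>-algebra.\<close>

definition localization ::
  "('r, 'z) ring_scheme \<Rightarrow> 'r \<Rightarrow> ('r, 'm) module \<Rightarrow> ('r, ('m \<times> nat) set) module" where
  "localization R s M =
    \<lparr>carrier = {frac R M s x k | x k. x \<in> carrier M},
     monoid.mult = (\<lambda>X Y. \<Union>(x, k)\<in>X. \<Union>(y, l)\<in>Y. frac R M s (x \<otimes>\<^bsub>M\<^esub> y) (k + l)),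
     one = frac R M s \<one>\<^bsub>M\<^esub> 0,
     zero = frac R M s \<zero>\<^bsub>M\<^esub> 0,
     add = (\<lambda>X Y. \<Union>(x, k)\<in>X. \<Union>(y, l)\<in>Y.
       frac R M s (((s [^]\<^bsub>R\<^esub> l) \<odot>\<^bsub>M\<^esub> x) \<oplus>\<^bsub>M\<^esub> ((s [^]\<^bsub>R\<^esub> k) \<odot>\<^bsub>M\<^esub> y)) (k + l)),
     smult = (\<lambda>a X. \<Union>(x, k)\<in>X. frac R M s (a \<odot>\<^bsub>M\<^esub> x) k)\<rparr>"

definition integral_over :: "('r, 'z) ring_scheme \<Rightarrow> ('r, 'm) module \<Rightarrow> 'm \<Rightarrow> bool" where
  "integral_over R L y \<longleftrightarrow>
     (\<exists>(n::nat) c. (\<forall>i<n. c i \<in> carrier R) \<and>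
        (y [^]\<^bsub>L\<^esub> n) \<oplus>\<^bsub>L\<^esub> (\<Oplus>\<^bsub>L\<^esub>i\<in>{..<n}. c i \<odot>\<^bsub>L\<^esub> (y [^]\<^bsub>L\<^esub> i)) = \<zero>\<^bsub>L\<^esub>)"

definition integrally_closed_in :: "('r, 'z) ring_scheme \<Rightarrow> ('r, 'm) module \<Rightarrow> bool" where
  "integrally_closed_in R L \<longleftrightarrow>
     (\<forall>y\<in>carrier L. integral_over R L y \<longrightarrow> y \<in> (\<lambda>r. r \<odot>\<^bsub>L\<^esub> \<one>\<^bsub>L\<^esub>) ` carrier R)"


section \<open>Local cohomology\<close>

text \<open>Local cohomology with support in the ideal generated by a finite sequence \<open>xs\<close> is the cohomology
  of the Cech complex, whose term in degree \<open>i\<close> is the direct sum of the \<open>M[1/x\<^sub>J]\<close> over the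
  \<open>i\<close>-element sets \<open>J\<close> of indices, \<open>x\<^sub>J\<close> being the product of the \<open>x\<^sub>j\<close>, \<open>j \<in> J\<close>.\<close>

definition cech_index :: "'r list \<Rightarrow> nat \<Rightarrow> nat set set" where
  "cech_index xs i = {J. J \<subseteq> {..<length xs} \<and> card J = i}"

definition cech_elt :: "('r, 'z) ring_scheme \<Rightarrow> 'r list \<Rightarrow> nat set \<Rightarrow> 'r" where
  "cech_elt R xs J = (\<Otimes>\<^bsub>R\<^esub>j\<in>J. xs ! j)"

definition cech ::
  "('r, 'z) ring_scheme \<Rightarrow> 'r list \<Rightarrow> ('r, 'm) module \<Rightarrow> nat
    \<Rightarrow> ('r, nat set \<Rightarrow> ('m \<times> nat) set) module" where
  "cech R xs M i =
    \<lparr>carrier = (\<Pi>\<^sub>E J\<in>cech_index xs i. carrier (localization R (cech_elt R xs J) M)),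
     monoid.mult = undefined, one = undefined,
     zero = (\<lambda>J\<in>cech_index xs i. \<zero>\<^bsub>localization R (cech_elt R xs J) M\<^esub>),
     add = (\<lambda>c c'. \<lambda>J\<in>cech_index xs i. c J \<oplus>\<^bsub>localization R (cech_elt R xs J) M\<^esub> c' J),
     smult = (\<lambda>a c. \<lambda>J\<in>cech_index xs i. a \<odot>\<^bsub>localization R (cech_elt R xs J) M\<^esub> c J)\<rparr>"

text \<open>The canonical map \<open>M[1/x\<^sub>J\<^sub>-\<^sub>{\<^sub>j\<^sub>}] \<rightarrow> M[1/x\<^sub>J]\<close> for \<open>j \<in> J\<close>; it multiplies numerator and
  denominator of a fraction by the appropriate power of \<open>x\<^sub>j\<close>.\<close>

definition cech_restr ::
  "('r, 'z) ring_scheme \<Rightarrow> 'r list \<Rightarrow> ('r, 'm) module \<Rightarrow> nat set \<Rightarrow> nat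
    \<Rightarrow> ('m \<times> nat) set \<Rightarrow> ('m \<times> nat) set" where
  "cech_restr R xs M J j X =
     (\<Union>(x, k)\<in>X. frac R M (cech_elt R xs J) (((xs ! j) [^]\<^bsub>R\<^esub> k) \<odot>\<^bsub>M\<^esub> x) k)"

definition cech_diff ::
  "('r, 'z) ring_scheme \<Rightarrow> 'r list \<Rightarrow> ('r, 'm) module \<Rightarrow> nat
    \<Rightarrow> (nat set \<Rightarrow> ('m \<times> nat) set) \<Rightarrow> nat set \<Rightarrow> ('m \<times> nat) set" where
  "cech_diff R xs M i c =
     (\<lambda>J\<in>cech_index xs (Suc i).
        \<Oplus>\<^bsub>localization R (cech_elt R xs J) M\<^esub>j\<in>J.
          (if even (card {l \<in> J. l < j}) then cech_restr R xs M J j (c (J - {j}))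
           else \<ominus>\<^bsub>localization R (cech_elt R xs J) M\<^esub> cech_restr R xs M J j (c (J - {j}))))"

definition cech_cocycles ::
  "('r, 'z) ring_scheme \<Rightarrow> 'r list \<Rightarrow> ('r, 'm) module \<Rightarrow> nat
    \<Rightarrow> (nat set \<Rightarrow> ('m \<times> nat) set) set" where
  "cech_cocycles R xs M i =
     {c \<in> carrier (cech R xs M i). cech_diff R xs M i c = \<zero>\<^bsub>cech R xs M (Suc i)\<^esub>}"

fun cech_coboundaries ::
  "('r, 'z) ring_scheme \<Rightarrow> 'r list \<Rightarrow> ('r, 'm) module \<Rightarrow> nat
    \<Rightarrow> (nat set \<Rightarrow> ('m \<times> nat) set) set" where
  "cech_coboundaries R xs M 0 = {\<zero>\<^bsub>cech R xs M 0\<^esub>}"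
| "cech_coboundaries R xs M (Suc i) = cech_diff R xs M i ` carrier (cech R xs M i)"

definition local_cohomology ::
  "('r, 'z) ring_scheme \<Rightarrow> 'r list \<Rightarrow> ('r, 'm) module \<Rightarrow> nat
    \<Rightarrow> ('r, (nat set \<Rightarrow> ('m \<times> nat) set) set) module" where
  "local_cohomology R xs M i =
     subquotient (cech R xs M i) (cech_cocycles R xs M i) (cech_coboundaries R xs M i)"

text \<open>For a ring map \<open>\<phi> : A \<rightarrow> S\<close>, the map from the local cohomology of \<open>A\<close> to that of \<open>S\<close>.  The Cech
  complex of the \<open>A\<close>-module \<open>S\<close> with respect to \<open>xs\<close> is that of the ring \<open>S\<close> with respect to the
  images of \<open>xs\<close>, which also carries the \<open>S\<close>-module structure.\<close>

definition local_cohomology_map ::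
  "('a, 'z) ring_scheme \<Rightarrow> ('s, 'y) ring_scheme \<Rightarrow> ('a \<Rightarrow> 's) \<Rightarrow> 'a list \<Rightarrow> nat
    \<Rightarrow> (nat set \<Rightarrow> ('a \<times> nat) set) set \<Rightarrow> (nat set \<Rightarrow> ('s \<times> nat) set) set" where
  "local_cohomology_map A S \<phi> xs i =
     quotient_map (cech S (map \<phi> xs) (self_module S) i)
       (cech_coboundaries S (map \<phi> xs) (self_module S) i)
       (\<lambda>c. \<lambda>J\<in>cech_index xs i.
          \<Union>(a, k)\<in>c J. frac S (self_module S) (cech_elt S (map \<phi> xs) J) (\<phi> a) k)"


section \<open>The base ring \<open>K\<^sup>\<circ>\<close>\<close>

definition Zp_ring :: "nat \<Rightarrow> (nat \<Rightarrow> int set) ring" where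
  "Zp_ring p = adic_completion int_ring (PIdl\<^bsub>int_ring\<^esub> (int p))"

definition p_exponents :: "nat \<Rightarrow> rat set" where
  "p_exponents p = {of_nat m / of_nat p ^ e | m e. True}"

text \<open>The monoid algebra over \<open>R\<close> of the monoid \<open>\<nat>[1/p]\<close>, that is, \<open>R[X\<^sup>1\<^sup>/\<^sup>p\<^sup>^\<^sup>\<infinity>]\<close>.\<close>

definition perfect_poly_ring :: "nat \<Rightarrow> ('r, 'z) ring_scheme \<Rightarrow> (rat \<Rightarrow> 'r) ring" where
  "perfect_poly_ring p R =
    \<lparr>carrier = carrier (free_module R (p_exponents p)),
     monoid.mult = (\<lambda>f g r. \<Oplus>\<^bsub>R\<^esub>a\<in>{a. f a \<noteq> \<zero>\<^bsub>R\<^esub> \<and> g (r - a) \<noteq> \<zero>\<^bsub>R\<^esub>}. f a \<otimes>\<^bsub>R\<^esub> g (r - a)),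
     one = basis_elt R 0,
     zero = (\<lambda>r. \<zero>\<^bsub>R\<^esub>),
     add = (\<lambda>f g r. f r \<oplus>\<^bsub>R\<^esub> g r)\<rparr>"

text \<open>\<open>\<int>\<^sub>p[p\<^sup>1\<^sup>/\<^sup>p\<^sup>^\<^sup>\<infinity>]\<close> is presented as \<open>\<int>\<^sub>p[X\<^sup>1\<^sup>/\<^sup>p\<^sup>^\<^sup>\<infinity>] / (X - p)\<close>: it is the union of the rings
  \<open>\<int>\<^sub>p[p\<^sup>1\<^sup>/\<^sup>p\<^sup>^\<^sup>e] = \<int>\<^sub>p[Y] / (Y\<^sup>p\<^sup>^\<^sup>e - p)\<close>, the polynomials being Eisenstein.\<close>

definition root_ideal :: "nat \<Rightarrow> (rat \<Rightarrow> nat \<Rightarrow> int set) set" where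
  "root_ideal p =
     PIdl\<^bsub>perfect_poly_ring p (Zp_ring p)\<^esub>
       (basis_elt (Zp_ring p) 1 \<ominus>\<^bsub>perfect_poly_ring p (Zp_ring p)\<^esub>
         [p] \<cdot>\<^bsub>perfect_poly_ring p (Zp_ring p)\<^esub> \<one>\<^bsub>perfect_poly_ring p (Zp_ring p)\<^esub>)"

definition Zp_roots :: "nat \<Rightarrow> (rat \<Rightarrow> nat \<Rightarrow> int set) set ring" where
  "Zp_roots p = perfect_poly_ring p (Zp_ring p) Quot root_ideal p"

type_synonym Kelt = "nat \<Rightarrow> (rat \<Rightarrow> nat \<Rightarrow> int set) set set"

definition Kcirc :: "nat \<Rightarrow> Kelt ring" where
  "Kcirc p = adic_completion (Zp_roots p) (PIdl\<^bsub>Zp_roots p\<^esub> ([p] \<cdot>\<^bsub>Zp_roots p\<^esub> \<one>\<^bsub>Zp_roots p\<^esub>))"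

text \<open>The element \<open>p\<^sup>1\<^sup>/\<^sup>p\<^sup>^\<^sup>k\<close> of \<open>K\<^sup>\<circ>\<close>.\<close>

definition p_root :: "nat \<Rightarrow> nat \<Rightarrow> Kelt" where
  "p_root p k =
     completion_map (Zp_roots p) (PIdl\<^bsub>Zp_roots p\<^esub> ([p] \<cdot>\<^bsub>Zp_roots p\<^esub> \<one>\<^bsub>Zp_roots p\<^esub>))
       (root_ideal p +>\<^bsub>perfect_poly_ring p (Zp_ring p)\<^esub>
          basis_elt (Zp_ring p) (1 / of_nat p ^ k))"


section \<open>Integral perfectoid algebras and almost mathematics\<close>

text \<open>A \<open>K\<^sup>\<circ>\<close>-algebra is a commutative ring \<open>S\<close> with a ring map \<open>\<kappa> : K\<^sup>\<circ> \<rightarrow> S\<close>, and every \<open>S\<close>-module is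
  a \<open>K\<^sup>\<circ>\<close>-module via \<open>\<kappa>\<close>.\<close>

definition integral_perfectoid :: "nat \<Rightarrow> ('s, 'y) ring_scheme \<Rightarrow> (Kelt \<Rightarrow> 's) \<Rightarrow> bool" where
  "integral_perfectoid p S \<kappa> \<longleftrightarrow>
     cring S \<and> \<kappa> \<in> ring_hom (Kcirc p) S \<and>
     adically_complete S (PIdl\<^bsub>S\<^esub> ([p] \<cdot>\<^bsub>S\<^esub> \<one>\<^bsub>S\<^esub>)) \<and>
     (\<forall>s\<in>carrier S. [p] \<cdot>\<^bsub>S\<^esub> s = \<zero>\<^bsub>S\<^esub> \<longrightarrow> s = \<zero>\<^bsub>S\<^esub>) \<and>
     (\<lambda>X. the_elem ((\<lambda>s. PIdl\<^bsub>S\<^esub> ([p] \<cdot>\<^bsub>S\<^esub> \<one>\<^bsub>S\<^esub>) +>\<^bsub>S\<^esub> (s [^]\<^bsub>S\<^esub> p)) ` X))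
       \<in> ring_iso (S Quot PIdl\<^bsub>S\<^esub> (\<kappa> (p_root p 1))) (S Quot PIdl\<^bsub>S\<^esub> ([p] \<cdot>\<^bsub>S\<^esub> \<one>\<^bsub>S\<^esub>)) \<and>
     integrally_closed_in S (localization S ([p] \<cdot>\<^bsub>S\<^esub> \<one>\<^bsub>S\<^esub>) (self_module S))"

definition almost_zero :: "nat \<Rightarrow> (Kelt \<Rightarrow> 's) \<Rightarrow> ('s, 'm) module \<Rightarrow> 'm \<Rightarrow> bool" where
  "almost_zero p \<kappa> N z \<longleftrightarrow> (\<forall>k>0. \<kappa> (p_root p k) \<odot>\<^bsub>N\<^esub> z = \<zero>\<^bsub>N\<^esub>)"

definition almost_zero_module :: "nat \<Rightarrow> (Kelt \<Rightarrow> 's) \<Rightarrow> ('s, 'm) module \<Rightarrow> bool" where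
  "almost_zero_module p \<kappa> N \<longleftrightarrow> (\<forall>z\<in>carrier N. almost_zero p \<kappa> N z)"

definition compatible_roots ::
  "nat \<Rightarrow> ('s, 'y) ring_scheme \<Rightarrow> 's \<Rightarrow> (nat \<Rightarrow> 's) \<Rightarrow> bool" where
  "compatible_roots p S g r \<longleftrightarrow>
     (\<forall>e. r e \<in> carrier S) \<and> r 0 = g \<and> (\<forall>e. r (Suc e) [^]\<^bsub>S\<^esub> p = r e)"

text \<open>Almost flatness of \<open>A \<rightarrow> S\<close>, and the condition that \<open>M \<otimes>\<^sub>A S\<close> almost zero implies \<open>M = 0\<close>,
  for all \<open>A\<close>-modules \<open>M\<close> with carrier in the type \<open>'m\<close>.  For \<open>'m = ('i \<Rightarrow> 'a) set\<close>, where \<open>'a\<close> is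
  the type of elements of \<open>A\<close>, these are, up to isomorphism, at least all modules with an
  \<open>'i\<close>-indexed family of generators, namely quotients of the finitely supported functions on \<open>'i\<close> by
  submodules.  In particular all cyclic modules are included, to which both conditions (the second
  in the presence of the first) reduce, so they do not depend on \<open>'i\<close>.\<close>

definition almost_flat ::
  "'m itself \<Rightarrow> nat \<Rightarrow> 'a ring \<Rightarrow> 's ring \<Rightarrow> (Kelt \<Rightarrow> 's) \<Rightarrow> ('a \<Rightarrow> 's) \<Rightarrow> bool" where
  "almost_flat T p A S \<kappa> \<phi> \<longleftrightarrow>
     (\<forall>(M :: ('a, 'm) module) i. module A M \<longrightarrow> i > 0 \<longrightarrow> almost_zero_module p \<kappa> (Tor A S \<phi> M i))"

definition almost_faithful ::
  "'m itself \<Rightarrow> nat \<Rightarrow> 'a ring \<Rightarrow> 's ring \<Rightarrow> (Kelt \<Rightarrow> 's) \<Rightarrow> ('a \<Rightarrow> 's) \<Rightarrow> bool" where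
  "almost_faithful T p A S \<kappa> \<phi> \<longleftrightarrow>
     (\<forall>M :: ('a, 'm) module. module A M \<longrightarrow>
        almost_zero_module p \<kappa> (base_change A S \<phi> M) \<longrightarrow> carrier M = {\<zero>\<^bsub>M\<^esub>})"


section \<open>The perfectoid test ideals\<close>

text \<open>\<open>xs\<close> is a finite sequence of generators of the maximal ideal, used to compute local cohomology.\<close>

definition zero_diamond ::
  "nat \<Rightarrow> 'a ring \<Rightarrow> 's ring \<Rightarrow> (Kelt \<Rightarrow> 's) \<Rightarrow> ('a \<Rightarrow> 's) \<Rightarrow> 'a list \<Rightarrow> nat \<Rightarrow> 'a set \<Rightarrow> real
    \<Rightarrow> (nat set \<Rightarrow> ('a \<times> nat) set) set set" where
  "zero_diamond p A S \<kappa> \<phi> xs d \<aa> t =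
     {\<eta> \<in> carrier (local_cohomology A xs (self_module A) d).
        \<forall>e>0. \<forall>f\<in>ideal_pow A \<aa> (nat \<lceil>t * real p ^ e\<rceil>). \<forall>r. compatible_roots p S (\<phi> f) r \<longrightarrow>
          almost_zero p \<kappa> (local_cohomology S (map \<phi> xs) (self_module S) d)
            (r e \<odot>\<^bsub>local_cohomology S (map \<phi> xs) (self_module S) d\<^esub>
              local_cohomology_map A S \<phi> xs d \<eta>)}"

definition tau_sharp ::
  "nat \<Rightarrow> 'a ring \<Rightarrow> 's ring \<Rightarrow> (Kelt \<Rightarrow> 's) \<Rightarrow> ('a \<Rightarrow> 's) \<Rightarrow> 'a list \<Rightarrow> nat \<Rightarrow> 'a set \<Rightarrow> real
    \<Rightarrow> 'a set" where
  "tau_sharp p A S \<kappa> \<phi> xs d \<aa> t =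
     annihilator A (local_cohomology A xs (self_module A) d) (zero_diamond p A S \<kappa> \<phi> xs d \<aa> t)"

text \<open>The versions for chosen roots: \<open>r i e\<close> is the chosen \<open>p\<^sup>e\<close>-th root of \<open>f\<^sub>i\<close>, for \<open>1 \<le> i \<le> n\<close>.
  The elements \<open>f\<^sub>i\<close> themselves enter only through their roots.\<close>

definition zero_diamond_seq ::
  "nat \<Rightarrow> 'a ring \<Rightarrow> 's ring \<Rightarrow> (Kelt \<Rightarrow> 's) \<Rightarrow> ('a \<Rightarrow> 's) \<Rightarrow> 'a list \<Rightarrow> nat
    \<Rightarrow> nat \<Rightarrow> (nat \<Rightarrow> nat \<Rightarrow> 's) \<Rightarrow> real \<Rightarrow> (nat set \<Rightarrow> ('a \<times> nat) set) set set" where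
  "zero_diamond_seq p A S \<kappa> \<phi> xs d n r t =
     {\<eta> \<in> carrier (local_cohomology A xs (self_module A) d).
        \<forall>e>0. \<forall>(a::nat) j. real a \<ge> t * real p ^ e \<longrightarrow> (\<forall>i\<in>{1..a}. j i \<in> {1..n}) \<longrightarrow>
          almost_zero p \<kappa> (local_cohomology S (map \<phi> xs) (self_module S) d)
            ((\<Otimes>\<^bsub>S\<^esub>i\<in>{1..a}. r (j i) e) \<odot>\<^bsub>local_cohomology S (map \<phi> xs) (self_module S) d\<^esub>
              local_cohomology_map A S \<phi> xs d \<eta>)}"

definition tau_sharp_seq ::
  "nat \<Rightarrow> 'a ring \<Rightarrow> 's ring \<Rightarrow> (Kelt \<Rightarrow> 's) \<Rightarrow> ('a \<Rightarrow> 's) \<Rightarrow> 'a list \<Rightarrow> nat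
    \<Rightarrow> nat \<Rightarrow> (nat \<Rightarrow> nat \<Rightarrow> 's) \<Rightarrow> real \<Rightarrow> 'a set" where
  "tau_sharp_seq p A S \<kappa> \<phi> xs d n r t =
     annihilator A (local_cohomology A xs (self_module A) d)
       (zero_diamond_seq p A S \<kappa> \<phi> xs d n r t)"

end

theory Submission
  imports Defs
begin

text \<open>Each inclusion of test ideals comes from the reverse inclusion of the submodules they annihilate.
  For (a), a product of \<open>a \<ge> tp\<^sup>e\<close> chosen \<open>p\<^sup>e\<close>-th roots belongs to a compatible system of roots of the
  corresponding product of the \<open>f\<^sub>i\<close>, which lies in \<open>\<aa>\<^sup>a \<subseteq> \<aa>\<^bsup>\<lceil>tp^e\<rceil>\<^esup>\<close>; (b) and (c) hold because the
  powers \<open>\<aa>\<^sup>k\<close> decrease with \<open>k\<close> and increase with \<open>\<aa>\<close>.\<close>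

lemma (in ring) ideal_pow_is_ideal:
  assumes "ideal I R"
  shows "ideal (ideal_pow R I k) R"
  by (induction k) (auto intro: oneideal ideal_prod_is_ideal assms)

lemma (in ring) ideal_pow_antimono:
  assumes "ideal I R" "k \<le> l"
  shows "ideal_pow R I l \<subseteq> ideal_pow R I k"
  using assms(2)
proof (induction rule: dec_induct)
  case (step l)
  have "ideal_pow R I (Suc l) \<subseteq> ideal_pow R I l"
    using ideal_prod_inter[OF ideal_pow_is_ideal[OF assms(1)] assms(1)] by auto
  then show ?case
    using step.IH by blast
qed simp

lemma (in ring) ideal_pow_mono:
  assumes "ideal I R" "ideal J R" "I \<subseteq> J"
  shows "ideal_pow R I k \<subseteq> ideal_pow R J k"
proof (induction k)
  case (Suc k)
  \<comment> \<open>This is rule induction on \<open>ideal_prod\<close>, the additive closure of the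
    products: a product of generators is carried over by the induction hypothesis and
    \<open>I \<subseteq> J\<close>, a sum by closure.\<close>
  have "x \<in> ideal_prod R (ideal_pow R J k) J" if "x \<in> ideal_prod R (ideal_pow R I k) I" for x
    using that by induction (use Suc assms(3) in \<open>auto intro: ideal_prod.intros\<close>)
  then show ?case
    by auto
qed simp

lemma (in cring) finprod_in_ideal_pow:
  assumes "ideal I R" "\<And>i. i \<in> {1..k} \<Longrightarrow> g i \<in> I"
  shows "(\<Otimes>i\<in>{1..k::nat}. g i) \<in> ideal_pow R I k"
  using assms(2)
proof (induction k)
  case (Suc k)
  have "I \<subseteq> carrier R"
    using assms(1) by (simp add: additive_subgroup.a_subset ideal.axioms(1))
  then have carr: "g \<in> {1..Suc k} \<rightarrow> carrier R"
    using Suc.prems by blast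
  have "(\<Otimes>i\<in>insert (Suc k) {1..k}. g i) = g (Suc k) \<otimes> (\<Otimes>i\<in>{1..k}. g i)"
    using carr by (intro finprod_insert) auto
  \<comment> \<open>\<open>finprod_insert\<close> puts the new factor on the left, whereas
    \<open>ideal_pow\<close> multiplies by \<open>I\<close> on the right.\<close>
  also have "\<dots> = (\<Otimes>i\<in>{1..k}. g i) \<otimes> g (Suc k)"
    using carr by (intro m_comm finprod_closed) auto
  also have "\<dots> \<in> ideal_pow R I (Suc k)"
    using Suc by (auto intro: ideal_prod.prod)
  finally show ?case
    by (simp add: atLeastAtMostSuc_conv)
qed simp

text \<open>Powers distribute over products in a commutative ring. For infinite \<open>B\<close>
  both sides are the default value \<open>\<one>\<close>, so finiteness need not be assumed.\<close>

lemma (in cring) finprod_pow: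
  assumes "g \<in> B \<rightarrow> carrier R"
  shows "finprod R g B [^] (k::nat) = (\<Otimes>i\<in>B. g i [^] k)"
  using assms
  by (induction B rule: infinite_finite_induct) (auto simp: Pi_def nat_pow_distrib)

text \<open>Taking \<open>p\<close>-th powers commutes with products, so root systems can be
  multiplied level by level. This supplies the systems needed for part (a).\<close>

lemma (in cring) compatible_roots_finprod:
  assumes "\<And>i. i \<in> B \<Longrightarrow> compatible_roots p R (g i) (\<rho> i)"
  shows "compatible_roots p R (finprod R g B) (\<lambda>e. \<Otimes>i\<in>B. \<rho> i e)"
proof -
  have carr: "(\<lambda>i. \<rho> i e) \<in> B \<rightarrow> carrier R" for e
    using assms by (auto simp: compatible_roots_def)
  have eqs: "\<rho> i 0 = g i" "\<rho> i (Suc e) [^] p = \<rho> i e" if "i \<in> B" for i e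
    using assms[OF that] by (auto simp: compatible_roots_def)
  then have "g \<in> B \<rightarrow> carrier R"
    using carr[of 0] by (auto simp: Pi_iff)
  then have "(\<Otimes>i\<in>B. \<rho> i 0) = finprod R g B"
    by (intro finprod_cong') (simp_all add: eqs)
  moreover have "(\<Otimes>i\<in>B. \<rho> i (Suc e)) [^] p = (\<Otimes>i\<in>B. \<rho> i e)" for e
    unfolding finprod_pow[OF carr] by (intro finprod_cong') (simp_all add: eqs carr)
  ultimately show ?thesis
    using carr by (simp add: compatible_roots_def finprod_closed)
qed

lemma annihilator_antimono: "X \<subseteq> Y \<Longrightarrow> annihilator R M Y \<subseteq> annihilator R M X"
  by (auto simp: annihilator_def)

lemma nat_ceiling_mult_power_mono:
  fixes t t' :: real
  assumes "t \<le> t'"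
  shows "nat \<lceil>t * real p ^ e\<rceil> \<le> nat \<lceil>t' * real p ^ e\<rceil>"
  using assms by (intro nat_mono ceiling_mono mult_right_mono) auto

text \<open>A larger exponent gives a smaller power of the ideal, hence fewer \<open>f\<close> to
  test and more classes that pass.\<close>

lemma zero_diamond_mono:
  assumes "ring A" "ideal \<aa> A" "t \<le> t'"
  shows "zero_diamond p A S \<kappa> \<phi> xs d \<aa> t \<subseteq> zero_diamond p A S \<kappa> \<phi> xs d \<aa> t'"
  unfolding zero_diamond_def
  using ring.ideal_pow_antimono[OF assms(1,2) nat_ceiling_mult_power_mono[OF assms(3)]] by blast

lemma zero_diamond_antimono:
  assumes "ring A" "ideal \<aa> A" "ideal \<bb> A" "\<aa> \<subseteq> \<bb>"
  shows "zero_diamond p A S \<kappa> \<phi> xs d \<bb> t \<subseteq> zero_diamond p A S \<kappa> \<phi> xs d \<aa> t"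
  unfolding zero_diamond_def using ring.ideal_pow_mono[OF assms] by blast

text \<open>A product long enough for \<open>t'\<close> is long enough for \<open>t\<close>, so each
  test for \<open>t'\<close> is among those for \<open>t\<close>.\<close>

lemma zero_diamond_seq_mono:
  assumes "t \<le> t'"
  shows "zero_diamond_seq p A S \<kappa> \<phi> xs d n r t \<subseteq> zero_diamond_seq p A S \<kappa> \<phi> xs d n r t'"
proof -
  have "t * real p ^ e \<le> real a" if "t' * real p ^ e \<le> real a" for e a
    using that mult_right_mono[OF assms, of "real p ^ e"] by simp
  then show ?thesis
    unfolding zero_diamond_seq_def by blast
qed

lemma zero_diamond_seq_antimono:
  assumes "n \<le> m"
  shows "zero_diamond_seq p A S \<kappa> \<phi> xs d m r t \<subseteq> zero_diamond_seq p A S \<kappa> \<phi> xs d n r t"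
proof -
  have "{1..n} \<subseteq> {1..m}"
    using assms by simp
  then show ?thesis
    unfolding zero_diamond_seq_def by blast
qed

text \<open>\<open>zero_diamond\<close> tests all elements of the ideal power together with all
  their root systems, so it suffices that each product of chosen roots occurs among these
  tests.\<close>

lemma zero_diamond_subset_seq:
  assumes "ring_hom_cring A S \<phi>" "ideal \<aa> A"
    and "\<And>i. i \<in> {1..n} \<Longrightarrow> f i \<in> \<aa>"
    and "\<And>i. i \<in> {1..n} \<Longrightarrow> compatible_roots p S (\<phi> (f i)) (r i)"
  shows "zero_diamond p A S \<kappa> \<phi> xs d \<aa> t \<subseteq> zero_diamond_seq p A S \<kappa> \<phi> xs d n r t"
proof -
  interpret ring_hom_cring A S \<phi> by fact
  interpret I: ideal \<aa> A by fact
  \<comment> \<open>The witness is the product of the \<open>f (j i)\<close>. The outer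
    \<open>e\<close> fixes the required exponent; the \<open>e\<close> bound by the lambda runs over
    all levels of the root system, with \<open>a\<close> and \<open>j\<close> held fixed.\<close>
  have *: "\<exists>g\<in>ideal_pow A \<aa> (nat \<lceil>t * real p ^ e\<rceil>).
      compatible_roots p S (\<phi> g) (\<lambda>e. \<Otimes>\<^bsub>S\<^esub>i\<in>{1..a}. r (j i) e)"
    if "real a \<ge> t * real p ^ e" and j: "\<forall>i\<in>{1..a}. j i \<in> {1..n}" for e a :: nat and j
  proof
    \<comment> \<open>As \<open>a\<close> is an integer, it dominates the ceiling too. The product
      lies in the \<open>a\<close>-th power, hence in the possibly larger power used by the
      test.\<close>
    have "nat \<lceil>t * real p ^ e\<rceil> \<le> a"
      using that(1) by (simp add: ceiling_le_iff nat_le_iff)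
    moreover have "(\<Otimes>\<^bsub>A\<^esub>i\<in>{1..a}. f (j i)) \<in> ideal_pow A \<aa> a"
      using assms(2,3) j by (intro R.finprod_in_ideal_pow) auto
    ultimately show "(\<Otimes>\<^bsub>A\<^esub>i\<in>{1..a}. f (j i)) \<in> ideal_pow A \<aa> (nat \<lceil>t * real p ^ e\<rceil>)"
      using R.ideal_pow_antimono[OF assms(2)] by blast
    have "(\<lambda>i. f (j i)) \<in> {1..a} \<rightarrow> carrier A"
      using assms(3) j I.a_subset by blast
    then show "compatible_roots p S (\<phi> (\<Otimes>\<^bsub>A\<^esub>i\<in>{1..a}. f (j i))) (\<lambda>e. \<Otimes>\<^bsub>S\<^esub>i\<in>{1..a}. r (j i) e)"
      using assms(4) j by (subst hom_finprod) (auto intro!: S.compatible_roots_finprod)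
  qed
  show ?thesis
  proof
    fix \<eta>
    assume \<eta>: "\<eta> \<in> zero_diamond p A S \<kappa> \<phi> xs d \<aa> t"
    have "almost_zero p \<kappa> (local_cohomology S (map \<phi> xs) (self_module S) d)
        ((\<Otimes>\<^bsub>S\<^esub>i\<in>{1..a}. r (j i) e) \<odot>\<^bsub>local_cohomology S (map \<phi> xs) (self_module S) d\<^esub>
          local_cohomology_map A S \<phi> xs d \<eta>)"
      if "e > 0" and aj: "real a \<ge> t * real p ^ e" "\<forall>i\<in>{1..a}. j i \<in> {1..n}" for e a :: nat and j
    proof -
      obtain g where g: "g \<in> ideal_pow A \<aa> (nat \<lceil>t * real p ^ e\<rceil>)"
          "compatible_roots p S (\<phi> g) (\<lambda>e. \<Otimes>\<^bsub>S\<^esub>i\<in>{1..a}. r (j i) e)"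
        using *[OF aj] by blast
      \<comment> \<open>The root system stays quantified here. Instantiating it by
        \<open>g(2)\<close> afterwards and evaluating at \<open>e\<close> gives exactly the product
        of chosen roots.\<close>
      have "\<forall>\<rho>. compatible_roots p S (\<phi> g) \<rho> \<longrightarrow>
          almost_zero p \<kappa> (local_cohomology S (map \<phi> xs) (self_module S) d)
            (\<rho> e \<odot>\<^bsub>local_cohomology S (map \<phi> xs) (self_module S) d\<^esub>
              local_cohomology_map A S \<phi> xs d \<eta>)"
        using \<eta> \<open>e > 0\<close> g(1)
        unfolding zero_diamond_def mem_Collect_eq by (elim conjE allE[of _ e] impE) auto
      from this[rule_format, OF g(2)] show ?thesis .
    qed
    with \<eta> show "\<eta> \<in> zero_diamond_seq p A S \<kappa> \<phi> xs d n r t"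
      unfolding zero_diamond_def zero_diamond_seq_def mem_Collect_eq by simp
  qed
qed

theorem proposition3p3:
  fixes p d n :: nat
    and A :: "'a ring" and \<mm> \<aa> :: "'a set"
    and S :: "'s ring" and \<kappa> :: "Kelt \<Rightarrow> 's" and \<phi> :: "'a \<Rightarrow> 's"
    and xs :: "'a list"
    and f :: "nat \<Rightarrow> 'a" and r :: "nat \<Rightarrow> nat \<Rightarrow> 's"
  assumes "prime p"
    and "regular_local_ring A \<mm> d" and "adically_complete A \<mm>" and "mixed_characteristic p A \<mm>"
    and "integral_perfectoid p S \<kappa>" and "\<phi> \<in> ring_hom A S"
    and "\<forall>g\<in>carrier A. \<exists>\<rho>. compatible_roots p S (\<phi> g) \<rho>"
    and "almost_flat TYPE(('i \<Rightarrow> 'a) set) p A S \<kappa> \<phi>"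
    and "almost_faithful TYPE(('i \<Rightarrow> 'a) set) p A S \<kappa> \<phi>"
    and "set xs \<subseteq> carrier A" and "Idl\<^bsub>A\<^esub> (set xs) = \<mm>"
    and "ideal \<aa> A" and "\<forall>i\<in>{1..n}. f i \<in> carrier A" and "Idl\<^bsub>A\<^esub> (f ` {1..n}) = \<aa>"
    and "\<forall>i\<in>{1..n}. compatible_roots p S (\<phi> (f i)) (r i)"
  shows "(\<forall>t\<ge>0. tau_sharp_seq p A S \<kappa> \<phi> xs d n r t \<subseteq> tau_sharp p A S \<kappa> \<phi> xs d \<aa> t) \<and>
    (\<forall>t t'. 0 \<le> t \<and> t < t' \<longrightarrow>
       tau_sharp p A S \<kappa> \<phi> xs d \<aa> t' \<subseteq> tau_sharp p A S \<kappa> \<phi> xs d \<aa> t \<and>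
       tau_sharp_seq p A S \<kappa> \<phi> xs d n r t' \<subseteq> tau_sharp_seq p A S \<kappa> \<phi> xs d n r t) \<and>
    (\<forall>\<bb> m. ideal \<bb> A \<and> \<aa> \<subseteq> \<bb> \<and> n \<le> m \<and>
       (\<forall>i\<in>{n+1..m}. f i \<in> carrier A \<and> compatible_roots p S (\<phi> (f i)) (r i)) \<and>
       Idl\<^bsub>A\<^esub> (f ` {1..m}) = \<bb> \<longrightarrow>
       (\<forall>t\<ge>0. tau_sharp p A S \<kappa> \<phi> xs d \<aa> t \<subseteq> tau_sharp p A S \<kappa> \<phi> xs d \<bb> t \<and>
          tau_sharp_seq p A S \<kappa> \<phi> xs d n r t \<subseteq> tau_sharp_seq p A S \<kappa> \<phi> xs d m r t))"
proof -
  have "cring A" "cring S"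
    using assms(2,5) by (auto simp: regular_local_ring_def local_ring_def integral_perfectoid_def)
  then have hom: "ring_hom_cring A S \<phi>" and "ring A"
    using assms(6) by (auto intro!: ring_hom_cring.intro ring_hom_cring_axioms.intro cring.axioms(1))
  have "f i \<in> \<aa>" if "i \<in> {1..n}" for i
  proof -
    have "f ` {1..n} \<subseteq> carrier A"
      using assms(13) by blast
    from ring.genideal_self[OF \<open>ring A\<close> this] show ?thesis
      using that assms(14) by blast
  qed
  then have a: "zero_diamond p A S \<kappa> \<phi> xs d \<aa> t \<subseteq> zero_diamond_seq p A S \<kappa> \<phi> xs d n r t" for t
    using assms(15) by (intro zero_diamond_subset_seq[OF hom assms(12)]) auto
  show ?thesis
    \<comment> \<open>After \<open>annihilator_antimono\<close> reverses the inclusions, (a) is the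
      fact \<open>a\<close>, (b) is monotonicity in the exponent, and (c) is antitonicity in the
      ideal and in the number of generators.\<close>
    unfolding tau_sharp_def tau_sharp_seq_def
    by (intro conjI allI impI annihilator_antimono a zero_diamond_seq_mono zero_diamond_seq_antimono
        zero_diamond_mono[OF \<open>ring A\<close> assms(12)] zero_diamond_antimono[OF \<open>ring A\<close> assms(12)]) auto
qed

end
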